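(* Let $\theta>0$, $\beta>1$, $\gamma=1/\theta$, and let $X_1,X_2,\ldots$ be independent real-valued random variables, defined on the same probability space, with common cumulative distribution function the Pseudo-Lindley distribution function with parameters $\theta,\beta$. For each $n\geq 1$, let $X^{(n)}$ denote the $n$-th (upper) record value of the sequence $X_1,X_2,\ldots$. Then, as $n\rightarrow+\infty$, $$\frac{X^{(n)}-\gamma n}{\gamma\sqrt{n}}$$ converges in distribution to the standard normal law $\mathcal{N}(0,1)$.
   Context: The Pseudo-Lindley distribution with parameters $\theta>0$ and $\beta>1$ is the law on $\mathbb{R}$ with density $$f(x)=\frac{\theta(\beta-1+\theta x)e^{-\theta x}}{\beta}\,1_{(x\geq 0)},$$ equivalently, its distribution function satisfies $1-F(x)=\beta^{-1}(\beta+\theta x)e^{-\theta x}$ for $x\geq 0$. Upper record values: the first record is $X^{(1)}=X_1$, at record time $u(1)=1$; recursively $u(n+1)=\inf\{j>u(n):\ X_j>X_{u(n)}\}$ and $X^{(n+1)}=X_{u(n+1)}$ (all record times are almost surely finite). *)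

theory Defs
  imports "HOL-Probability.Probability"
begin

definition pseudo_lindley_density :: "real \<Rightarrow> real \<Rightarrow> real \<Rightarrow> real" where
  "pseudo_lindley_density \<theta> \<beta> x =
     (if x \<ge> 0 then \<theta> * (\<beta> - 1 + \<theta> * x) * exp (- \<theta> * x) / \<beta> else 0)"

definition pseudo_lindley :: "real \<Rightarrow> real \<Rightarrow> real measure" where
  "pseudo_lindley \<theta> \<beta> = density lborel (\<lambda>x. ennreal (pseudo_lindley_density \<theta> \<beta> x))"

lemma borel_measurable_pseudo_lindley_density [measurable]:
  "pseudo_lindley_density \<theta> \<beta> \<in> borel_measurable borel"
  unfolding pseudo_lindley_density_def [abs_def] by measurable

lemma DERIV_pseudo_lindley_tail:
  fixes \<theta> \<beta> x :: real
  assumes "\<beta> > 1"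
  shows "((\<lambda>x. - ((\<beta> + \<theta> * x) * exp (- \<theta> * x) / \<beta>)) has_real_derivative
           \<theta> * (\<beta> - 1 + \<theta> * x) * exp (- \<theta> * x) / \<beta>) (at x)"
  using assms by (auto intro!: derivative_eq_intros simp: field_simps)

lemma pseudo_lindley_density_nonneg:
  fixes \<theta> \<beta> x :: real
  assumes "\<theta> > 0" "\<beta> > 1" "x \<ge> 0"
  shows "\<theta> * (\<beta> - 1 + \<theta> * x) * exp (- \<theta> * x) / \<beta> \<ge> 0"
  by (intro divide_nonneg_nonneg mult_nonneg_nonneg add_nonneg_nonneg) (use assms in auto)

lemma prob_space_pseudo_lindley:
  assumes "\<theta> > 0" "\<beta> > 1"
  shows "prob_space (pseudo_lindley \<theta> \<beta>)"
proof
  let ?f = "\<lambda>x. \<theta> * (\<beta> - 1 + \<theta> * x) * exp (- \<theta> * x) / \<beta>"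
  have lim: "((\<lambda>x. - ((\<beta> + \<theta> * x) * exp (- \<theta> * x) / \<beta>)) \<longlongrightarrow> 0) at_top"
    using assms by real_asymp
  have "emeasure (pseudo_lindley \<theta> \<beta>) UNIV = (\<integral>\<^sup>+x. ennreal (?f x) * indicator {0..} x \<partial>lborel)"
    unfolding pseudo_lindley_def pseudo_lindley_density_def
    by (subst emeasure_density) (auto intro!: nn_integral_cong split: split_indicator)
  also have "\<dots> = ennreal (0 - (- ((\<beta> + \<theta> * 0) * exp (- \<theta> * 0) / \<beta>)))"
    by (intro nn_integral_FTC_atLeast lim DERIV_pseudo_lindley_tail pseudo_lindley_density_nonneg assms)
       (use assms in auto)
  also have "\<dots> = 1" using assms by simp
  finally show "emeasure (pseudo_lindley \<theta> \<beta>) (space (pseudo_lindley \<theta> \<beta>)) = 1"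
    by (simp add: pseudo_lindley_def)
qed

lemma cdf_pseudo_lindley:
  assumes "\<theta> > 0" "\<beta> > 1"
  shows "cdf (pseudo_lindley \<theta> \<beta>) x =
           (if x \<ge> 0 then 1 - (\<beta> + \<theta> * x) * exp (- \<theta> * x) / \<beta> else 0)"
proof -
  let ?f = "\<lambda>x. \<theta> * (\<beta> - 1 + \<theta> * x) * exp (- \<theta> * x) / \<beta>"
  let ?F = "\<lambda>x. - ((\<beta> + \<theta> * x) * exp (- \<theta> * x) / \<beta>)"
  have em: "emeasure (pseudo_lindley \<theta> \<beta>) {..x}
              = (\<integral>\<^sup>+y. ennreal (?f y) * indicator {0..x} y \<partial>lborel)"
    unfolding pseudo_lindley_def pseudo_lindley_density_def
    by (subst emeasure_density) (auto intro!: nn_integral_cong split: split_indicator)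
  show ?thesis
  proof (cases "x \<ge> 0")
    case True
    have "(\<integral>\<^sup>+y. ennreal (?f y) * indicator {0..x} y \<partial>lborel) = ennreal (?F x - ?F 0)"
      by (rule nn_integral_FTC_Icc [OF _ DERIV_pseudo_lindley_tail [OF assms(2)]
            pseudo_lindley_density_nonneg [OF assms]])
         (use True in auto)
    moreover have "?F 0 \<le> ?F x"
      by (rule DERIV_nonneg_imp_nondecreasing [OF True])
         (use DERIV_pseudo_lindley_tail [OF assms(2)] pseudo_lindley_density_nonneg [OF assms]
           in blast)
    ultimately show ?thesis
      using True assms by (simp add: cdf_def measure_def em)
  next
    case False
    then show ?thesis by (simp add: cdf_def measure_def em)
  qed
qed

text \<open>
  Sequences and record times are indexed from 1; the value at index 0 is a mere convention.
  The infimum is taken in \<^typ>\<open>enat\<close>, so a record that never occurs has record time \<open>\<infinity>\<close>,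
  and so do all later ones.
\<close>

fun record_time :: "(nat \<Rightarrow> real) \<Rightarrow> nat \<Rightarrow> enat" where
  "record_time x 0 = 0"
| "record_time x (Suc 0) = 1"
| "record_time x (Suc (Suc n)) =
     Inf {enat j | j. record_time x (Suc n) < enat j \<and> x (the_enat (record_time x (Suc n))) < x j}"

text \<open>
  The value 0 at an infinite record time only makes the function total; for an i.i.d. sequence
  with a continuous distribution function it is used with probability 0.
\<close>

definition record_value :: "(nat \<Rightarrow> real) \<Rightarrow> nat \<Rightarrow> real" where
  "record_value x n = (case record_time x n of enat k \<Rightarrow> x k | \<infinity> \<Rightarrow> 0)"

end

theory Submission
  imports Defs
begin

text \<open>
  The cumulative hazard \<open>R x = - ln (1 - F x) = \<theta> x - ln ((\<beta> + \<theta> x) / \<beta>)\<close> turns Pseudo-Lindley variables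
  into standard exponential ones, and since it is strictly increasing it maps records to records. So
  the record value \<open>X\<^bsup>(n)\<^esup>\<close> satisfies \<open>R X\<^bsup>(n)\<^esup> = S\<close>, where \<open>S\<close> is the \<open>n\<close>-th record of a
  sequence of independent standard exponential variables.

  By memorylessness the successive overshoots of exponential records are again independent standard
  exponentials, so \<open>S\<close> has the law of a sum of \<open>n\<close> of them. Its characteristic function
  \<open>1 / (1 - \<i> t) ^ n\<close> comes from a martingale rather than from a decomposition of \<open>S\<close>:
  with \<open>N\<close> the number of records among the first \<open>m\<close> observations and \<open>V\<close> their maximum, the process
  \<open>(1 - \<i> t) ^ N * exp (\<i> t V)\<close>, stopped at the \<open>n\<close>-th record, has constant mean 1
  (\<open>expectation_record_scan\<close>), because a single new observation leaves it unchanged on average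
  (\<open>integral_overshoot_exponential_eq_0\<close>). Each step rests on the independence of one observation
  from the past. Letting \<open>m\<close> tend to infinity yields
  \<open>char_record_value_exponential\<close>, and Levy's continuity theorem then gives the normal limit of
  \<open>(S - n) / sqrt n\<close> (\<open>exponential_record_central_limit\<close>).

  To return to \<open>X\<^bsup>(n)\<^esup>\<close>, the event that its standardisation is at most \<open>t\<close> is the event that
  \<open>(S - n) / sqrt n\<close> is at most \<open>s n\<close>, where \<open>s n\<close> differs from \<open>t\<close> by a term of order \<open>ln n / sqrt n\<close>.
  Since the normal distribution function is continuous, convergence of distribution functions
  persists at such moving points (\<open>weak_conv_at_moving_point\<close>).
\<close>

section \<open>Record times\<close>

text \<open>
  The infimum in the recursion for record times is attained whenever it is finite. In this form a
  record time is described by finitely many comparisons, which is what both measurability and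
  invariance under increasing maps rest on.
\<close>
lemma record_time_Suc_Suc_eq_enat_iff:
  "record_time x (Suc (Suc n)) = enat j \<longleftrightarrow>
     (\<exists>i<j. record_time x (Suc n) = enat i \<and> x i < x j \<and> (\<forall>l. i < l \<longrightarrow> l < j \<longrightarrow> x l \<le> x i))"
proof -
  define A where
    "A = {enat j | j. record_time x (Suc n) < enat j \<and> x (the_enat (record_time x (Suc n))) < x j}"
  have rt: "record_time x (Suc (Suc n)) = Inf A" by (simp add: A_def)
  show ?thesis
  proof
    assume *: "record_time x (Suc (Suc n)) = enat j"
    then have "A \<noteq> {}" unfolding rt Inf_enat_def by auto
    then have "Inf A \<in> A" by (auto simp: Inf_enat_def intro: LeastI)
    then have jA: "enat j \<in> A" using * rt by simp
    then obtain i where i: "record_time x (Suc n) = enat i"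
      by (cases "record_time x (Suc n)") (auto simp: A_def)
    have "x l \<le> x i" if "i < l" "l < j" for l
    proof (rule ccontr)
      assume "\<not> x l \<le> x i"
      then have "enat l \<in> A" using that i by (auto simp: A_def)
      then have "Inf A \<le> enat l" by (rule Inf_lower)
      then show False using * that unfolding rt by simp
    qed
    then show "\<exists>i<j. record_time x (Suc n) = enat i \<and> x i < x j \<and>
        (\<forall>l. i < l \<longrightarrow> l < j \<longrightarrow> x l \<le> x i)"
      using jA i by (auto simp: A_def)
  next
    assume "\<exists>i<j. record_time x (Suc n) = enat i \<and> x i < x j \<and>
        (\<forall>l. i < l \<longrightarrow> l < j \<longrightarrow> x l \<le> x i)"
    then obtain i where i: "i < j" "record_time x (Suc n) = enat i" "x i < x j"
      "\<And>l. i < l \<Longrightarrow> l < j \<Longrightarrow> x l \<le> x i" by blast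
    have "Inf A = enat j"
    proof (rule antisym)
      show "Inf A \<le> enat j" by (rule Inf_lower) (use i in \<open>auto simp: A_def\<close>)
      show "enat j \<le> Inf A"
      proof (rule Inf_greatest)
        fix a assume "a \<in> A"
        then obtain l where "a = enat l" "i < l" "x i < x l" using i by (auto simp: A_def)
        then show "enat j \<le> a" using i(4)[of l] by (cases "l < j") auto
      qed
    qed
    then show "record_time x (Suc (Suc n)) = enat j" using rt by simp
  qed
qed

lemma record_time_pos:
  assumes "record_time x (Suc n) = enat k"
  shows "1 \<le> k"
  using assms
proof (cases n)
  case 0 with assms show ?thesis by (simp add: one_enat_def)
next
  case (Suc m)
  then obtain i where "i < k" using assms record_time_Suc_Suc_eq_enat_iff by metis
  then show ?thesis by simp
qed

text \<open>
  The description of record times mentions the terms of the sequence only through comparisons.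
\<close>
lemma record_time_eq_if_same_order:
  assumes "\<And>i j. 1 \<le> i \<Longrightarrow> 1 \<le> j \<Longrightarrow> x i < x j \<longleftrightarrow> y i < y j"
  shows "record_time x n = record_time y n"
proof (cases n)
  case (Suc m)
  have "record_time x (Suc m) = enat j \<longleftrightarrow> record_time y (Suc m) = enat j" for j
  proof (induction m arbitrary: j)
    case (Suc m)
    have *: "x i \<le> x l \<longleftrightarrow> y i \<le> y l" if "1 \<le> i" "1 \<le> l" for i l
      using assms[of l i] that by (meson not_le)
    show ?case unfolding record_time_Suc_Suc_eq_enat_iff Suc.IH
      by (intro ex_cong1 conj_cong refl)
         (auto simp: assms * dest!: record_time_pos)
  qed simp
  then show ?thesis unfolding Suc
    by (metis enat_def not_enat_eq)
qed simp

section \<open>Scanning a sequence for its first records\<close>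

text \<open>
  The state after \<open>m\<close> observations is the pair (number of records so far, running maximum), frozen as
  soon as there are \<open>n\<close> records. Freezing keeps the count at most \<open>n\<close>, so that functions of the state
  which grow exponentially in the count stay bounded. The start \<open>(0, 0)\<close> makes the first observation
  a record as soon as it is positive.
\<close>
primrec record_scan :: "nat \<Rightarrow> (nat \<Rightarrow> real) \<Rightarrow> nat \<Rightarrow> nat \<times> real" where
  "record_scan n y 0 = (0, 0)"
| "record_scan n y (Suc m) =
     (if fst (record_scan n y m) < n \<and> snd (record_scan n y m) < y (Suc m)
      then (Suc (fst (record_scan n y m)), y (Suc m)) else record_scan n y m)"

lemma record_scan_cong:
  assumes "\<And>i. 1 \<le> i \<Longrightarrow> i \<le> m \<Longrightarrow> x i = y i"
  shows "record_scan n x m = record_scan n y m"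
  using assms by (induction m) auto

lemma fst_record_scan_le: "fst (record_scan n y m) \<le> n"
  by (induction m) auto

lemma snd_record_scan_nonneg: "0 \<le> snd (record_scan n y m)"
  by (induction m) auto

lemma fst_record_scan_mono: "m \<le> m' \<Longrightarrow> fst (record_scan n y m) \<le> fst (record_scan n y m')"
  by (induction m' rule: dec_induct) auto

text \<open>
  The running maximum moves only together with the count.
\<close>
lemma record_scan_eq_if_fst_eq:
  "m \<le> m' \<Longrightarrow> fst (record_scan n y m') = fst (record_scan n y m) \<Longrightarrow>
     record_scan n y m' = record_scan n y m"
proof (induction m' rule: dec_induct)
  case (step k)
  have "fst (record_scan n y m) \<le> fst (record_scan n y k)"
    by (rule fst_record_scan_mono) fact
  with step show ?case by (auto split: if_splits)
qed simp

text \<open>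
  The link between the scan and the recursive record times: when the count is \<open>k\<close>, the running maximum
  sits at the \<open>k\<close>-th record time. The last conjunct, that nothing since then has exceeded it, is what
  makes the next exceedance the next record; it may fail once the scan is frozen, hence the
  restriction to counts below \<open>n\<close>.
\<close>
lemma record_scan_record_time:
  assumes "0 < y 1" "1 \<le> n" "1 \<le> m"
  shows "\<exists>j. j \<le> m \<and> 1 \<le> fst (record_scan n y m) \<and>
           record_time y (fst (record_scan n y m)) = enat j \<and> y j = snd (record_scan n y m) \<and>
           (fst (record_scan n y m) < n \<longrightarrow> (\<forall>l. j < l \<longrightarrow> l \<le> m \<longrightarrow> y l \<le> y j))"
  using \<open>1 \<le> m\<close>
proof (induction m rule: dec_induct)
  case base
  show ?case using assms by (auto simp: one_enat_def)
next
  case (step m)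
  let ?s = "record_scan n y m"
  from step.IH obtain j where j: "j \<le> m" "1 \<le> fst ?s" "record_time y (fst ?s) = enat j"
    "y j = snd ?s" "fst ?s < n \<Longrightarrow> \<forall>l. j < l \<longrightarrow> l \<le> m \<longrightarrow> y l \<le> y j" by auto
  show ?case
  proof (cases "fst ?s < n \<and> snd ?s < y (Suc m)")
    case True
    obtain k where k: "fst ?s = Suc k" using j(2) by (cases "fst ?s") auto
    have "record_time y (Suc (Suc k)) = enat (Suc m)"
      unfolding record_time_Suc_Suc_eq_enat_iff using j True k by (intro exI[of _ j]) auto
    then show ?thesis using True k by (intro exI[of _ "Suc m"]) auto
  next
    case False
    then have "record_scan n y (Suc m) = ?s" by auto
    then show ?thesis using j False
      by (intro exI[of _ j]) (auto simp: le_Suc_eq)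
  qed
qed

text \<open>
  In an unbounded sequence every current maximum is eventually exceeded, and each exceedance raises
  the count by one until it is \<open>n\<close>.
\<close>
lemma record_scan_reaches:
  assumes "\<And>c m. \<exists>j>m. c < y j" and "k \<le> n"
  shows "\<exists>m\<ge>1. k \<le> fst (record_scan n y m)"
  using \<open>k \<le> n\<close>
proof (induction k)
  case 0 show ?case by auto
next
  case (Suc k)
  then obtain m where m: "1 \<le> m" "k \<le> fst (record_scan n y m)" by auto
  obtain j where j: "m < j" "snd (record_scan n y m) < y j" using assms(1) by blast
  then obtain i where i: "j = Suc i" "m \<le> i" by (cases j) auto
  have le: "k \<le> fst (record_scan n y i)" using m fst_record_scan_mono[OF i(2), of n y] by linarith
  show ?case
  proof (cases "fst (record_scan n y i) = k")
    case True
    then have "record_scan n y i = record_scan n y m"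
      using m fst_record_scan_mono[OF i(2), of n y] i by (intro record_scan_eq_if_fst_eq) auto
    then have "Suc k \<le> fst (record_scan n y j)" using True Suc.prems i j by simp
    then show ?thesis using m(1) j(1) by (intro exI[of _ j]) auto
  next
    case False
    with le m(1) i show ?thesis by (intro exI[of _ i]) auto
  qed
qed

lemma eventually_record_scan_eq:
  assumes "0 < y 1" "1 \<le> n" and unb: "\<And>c m. \<exists>j>m. c < y j"
  shows "record_time y n \<noteq> \<infinity>"
    and "eventually (\<lambda>m. record_scan n y m = (n, record_value y n)) sequentially"
proof -
  obtain m0 where m0: "1 \<le> m0" "n \<le> fst (record_scan n y m0)"
    using record_scan_reaches[of y n n] unb by auto
  have *: "record_time y n \<noteq> \<infinity> \<and> record_scan n y m = (n, record_value y n)" if "m0 \<le> m" for m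
  proof -
    have "fst (record_scan n y m) = n"
      using m0 fst_record_scan_mono[OF that, of n y] fst_record_scan_le[of n y m] by simp
    with record_scan_record_time[of y n m, OF assms(1,2)] m0 that obtain j
      where "record_time y n = enat j" "y j = snd (record_scan n y m)" by auto
    then show ?thesis using \<open>fst _ = n\<close>
      by (auto simp: record_value_def prod_eq_iff)
  qed
  show "record_time y n \<noteq> \<infinity>" using *[of m0] by simp
  show "eventually (\<lambda>m. record_scan n y m = (n, record_value y n)) sequentially"
    using * unfolding eventually_sequentially by blast
qed

section \<open>Measurability\<close>

lemma measurable_record_scan:
  assumes "\<And>i. 1 \<le> i \<Longrightarrow> i \<le> m \<Longrightarrow> Y i \<in> borel_measurable N"
  shows "(\<lambda>\<omega>. record_scan n (\<lambda>i. Y i \<omega>) m) \<in> measurable N (count_space UNIV \<Otimes>\<^sub>M borel)"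
  using assms
proof (induction m)
  case (Suc m)
  have [measurable]: "(\<lambda>\<omega>. record_scan n (\<lambda>i. Y i \<omega>) m) \<in> measurable N (count_space UNIV \<Otimes>\<^sub>M borel)"
    "Y (Suc m) \<in> borel_measurable N"
    using Suc by auto
  show ?case unfolding record_scan.simps by measurable
qed simp

text \<open>
  The event that a record time after the first is \<open>j\<close> is a finite union over the possible previous record
  times, and there are only countably many values of a record time.
\<close>
lemma measurable_record_time:
  assumes "\<And>i. 1 \<le> i \<Longrightarrow> Y i \<in> borel_measurable N"
  shows "(\<lambda>\<omega>. record_time (\<lambda>i. Y i \<omega>) (Suc n)) \<in> measurable N (count_space UNIV)"
proof (induction n)
  case (Suc n)
  note Suc.IH [measurable]
  let ?rt = "\<lambda>\<omega>. record_time (\<lambda>i. Y i \<omega>)"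
  have fin: "{\<omega> \<in> space N. ?rt \<omega> (Suc (Suc n)) = enat j} \<in> sets N" for j
  proof -
    have "{\<omega> \<in> space N. ?rt \<omega> (Suc (Suc n)) = enat j} =
      (\<Union>i\<in>{1..<j}. {\<omega> \<in> space N. ?rt \<omega> (Suc n) = enat i} \<inter> {\<omega> \<in> space N. Y i \<omega> < Y j \<omega>} \<inter>
         {\<omega> \<in> space N. \<forall>l\<in>{i<..<j}. Y l \<omega> \<le> Y i \<omega>})"
      unfolding record_time_Suc_Suc_eq_enat_iff
      by (fastforce dest: record_time_pos simp del: record_time.simps)
    also have "\<dots> \<in> sets N"
    proof (intro sets.finite_UN sets.Int finite_atLeastLessThan)
      fix i assume i: "i \<in> {1..<j}"
      have [measurable]: "Y i \<in> borel_measurable N" "Y j \<in> borel_measurable N"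
        using i assms by auto
      show "{\<omega> \<in> space N. ?rt \<omega> (Suc n) = enat i} \<in> sets N" by measurable
      show "{\<omega> \<in> space N. Y i \<omega> < Y j \<omega>} \<in> sets N" by measurable
      show "{\<omega> \<in> space N. \<forall>l\<in>{i<..<j}. Y l \<omega> \<le> Y i \<omega>} \<in> sets N"
        by (intro sets.sets_Collect_finite_All borel_measurable_le assms) (use i in auto)
    qed
    finally show ?thesis .
  qed
  have "{\<omega> \<in> space N. ?rt \<omega> (Suc (Suc n)) = a} \<in> sets N" for a
  proof (cases a)
    case infinity
    have "{\<omega> \<in> space N. ?rt \<omega> (Suc (Suc n)) = a} =
        space N - (\<Union>j. {\<omega> \<in> space N. ?rt \<omega> (Suc (Suc n)) = enat j})"
      unfolding infinity by (auto simp del: record_time.simps)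
    also have "\<dots> \<in> sets N" using fin by auto
    finally show ?thesis .
  qed (simp add: fin del: record_time.simps)
  then show ?case
    by (subst measurable_count_space_eq_countable)
       (auto simp: vimage_def Int_def conj_commute simp del: record_time.simps)
qed simp

text \<open>
  The values \<open>Y k\<close> of countably many random variables are glued along the record time.
\<close>
lemma measurable_record_value:
  assumes "\<And>i. 1 \<le> i \<Longrightarrow> Y i \<in> borel_measurable N" "1 \<le> n"
  shows "(\<lambda>\<omega>. record_value (\<lambda>i. Y i \<omega>) n) \<in> borel_measurable N"
proof -
  obtain m where n: "n = Suc m" using assms by (cases n) auto
  \<comment> \<open>Record times are at least 1, so index 0, where \<open>Y 0\<close> may fail to be measurable, is given the value 0.\<close>
  have "(\<lambda>\<omega>. (\<lambda>a \<omega>. case a of enat k \<Rightarrow> if k = 0 then 0 else Y k \<omega> | \<infinity> \<Rightarrow> 0)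
            (record_time (\<lambda>i. Y i \<omega>) n) \<omega>) \<in> borel_measurable N"
  proof (rule measurable_compose_countable)
    fix a :: enat
    show "(\<lambda>\<omega>. case a of enat k \<Rightarrow> if k = 0 then 0 else Y k \<omega> | \<infinity> \<Rightarrow> 0) \<in> borel_measurable N"
      using assms(1) by (cases a; cases "a = 0") (auto simp: Suc_le_eq zero_enat_def)
    show "(\<lambda>\<omega>. record_time (\<lambda>i. Y i \<omega>) n) \<in> measurable N (count_space UNIV)"
      unfolding n using assms(1) by (rule measurable_record_time)
  qed
  also have "(\<lambda>\<omega>. (\<lambda>a \<omega>. case a of enat k \<Rightarrow> if k = 0 then 0 else Y k \<omega> | \<infinity> \<Rightarrow> 0)
            (record_time (\<lambda>i. Y i \<omega>) n) \<omega>) = (\<lambda>\<omega>. record_value (\<lambda>i. Y i \<omega>) n)"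
    using record_time_pos unfolding n record_value_def
    by (force split: enat.splits simp: fun_eq_iff simp del: record_time.simps)
  finally show ?thesis .
qed

section \<open>Records of independent exponential variables\<close>

text \<open>
  For a level \<open>c\<close>, the next \<open>K\<close> observations all stay below \<open>c\<close> with probability \<open>(1 - exp (- c)) ^ K\<close>,
  which vanishes as \<open>K\<close> grows; countably many levels suffice. This is what makes all record times
  almost surely finite.
\<close>
lemma (in prob_space) AE_unbounded_if_exponential:
  assumes indep: "indep_vars (\<lambda>_. borel) Y {1..}"
    and exp: "\<And>i::nat. 1 \<le> i \<Longrightarrow> distributed M lborel (Y i) (exponential_density 1)"
  shows "AE \<omega> in M. \<forall>c m. \<exists>j>m. c < Y j \<omega>"
proof -
  have meas: "Y i \<in> borel_measurable M" if "1 \<le> i" for i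
    using distributed_measurable[OF exp[OF that]] by simp
  have "AE \<omega> in M. \<exists>j>m. real c < Y j \<omega>" for c m :: nat
  proof -
    define q where "q = 1 - exp (- real c)"
    have bound: "prob {\<omega> \<in> space M. \<forall>j>m. Y j \<omega> \<le> real c} \<le> q ^ K" if "1 \<le> K" for K
    proof -
      have "prob {\<omega> \<in> space M. \<forall>j>m. Y j \<omega> \<le> real c} \<le>
          prob (\<Inter>j\<in>{m<..m+K}. Y j -` {..real c} \<inter> space M)"
        using that meas
        by (intro finite_measure_mono sets.finite_INT) (auto intro!: measurable_sets)
      also have "\<dots> = (\<Prod>j\<in>{m<..m+K}. prob (Y j -` {..real c} \<inter> space M))"
        using that by (intro indep_varsD[OF indep]) auto
      also have "\<dots> = (\<Prod>j\<in>{m<..m+K}. q)"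
      proof (rule prod.cong)
        fix j assume "j \<in> {m<..m+K}"
        then have "prob {\<omega> \<in> space M. Y j \<omega> \<le> real c} = q"
          using exponential_distributedD_le[OF exp[of j], of "real c"] by (simp add: q_def)
        moreover have "Y j -` {..real c} \<inter> space M = {\<omega> \<in> space M. Y j \<omega> \<le> real c}" by auto
        ultimately show "prob (Y j -` {..real c} \<inter> space M) = q" by simp
      qed simp
      finally show ?thesis by simp
    qed
    have "(\<lambda>K. q ^ K) \<longlonglongrightarrow> 0" by (rule LIMSEQ_power_zero) (auto simp: q_def)
    then have le0: "prob {\<omega> \<in> space M. \<forall>j>m. Y j \<omega> \<le> real c} \<le> 0"
      by (rule LIMSEQ_le_const) (intro exI[of _ 1] allI impI bound)
    show ?thesis
    proof (rule AE_I)
      show "{\<omega> \<in> space M. \<not> (\<exists>j>m. real c < Y j \<omega>)} \<subseteq>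
          {\<omega> \<in> space M. \<forall>j>m. Y j \<omega> \<le> real c}"
        by (auto intro: leI)
      show "emeasure M {\<omega> \<in> space M. \<forall>j>m. Y j \<omega> \<le> real c} = 0"
        using le0 unfolding emeasure_eq_measure measure_le_0_iff by simp
      have "{\<omega> \<in> space M. \<forall>j>m. Y j \<omega> \<le> real c} =
          space M - (\<Union>j\<in>{m<..}. {\<omega> \<in> space M. real c < Y j \<omega>})"
        by (auto simp: not_less)
      also have "\<dots> \<in> events" using meas by (intro sets.Diff sets.countable_UN') auto
      finally show "{\<omega> \<in> space M. \<forall>j>m. Y j \<omega> \<le> real c} \<in> events" .
    qed
  qed
  then have "AE \<omega> in M. \<forall>c m. \<exists>j>m. real c < Y j \<omega>" by (simp add: AE_all_countable)
  then show ?thesis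
  proof eventually_elim
    case (elim \<omega>)
    show ?case
    proof (intro allI)
      fix c :: real and m
      obtain k where "c < real k" using reals_Archimedean2 by blast
      moreover obtain j where "m < j" "real k < Y j \<omega>" using elim by blast
      ultimately show "\<exists>j>m. c < Y j \<omega>" by (intro exI[of _ j]) auto
    qed
  qed
qed

lemma (in prob_space) AE_pos_if_exponential:
  assumes "distributed M lborel Z (exponential_density 1)"
  shows "AE \<omega> in M. 0 < Z \<omega>"
proof -
  have [measurable]: "Z \<in> borel_measurable M" using distributed_measurable[OF assms] by simp
  have "prob {\<omega> \<in> space M. 0 < Z \<omega>} = 1"
    using exponential_distributedD_gt[OF assms, of 0] by simp
  then show ?thesis by (subst (asm) prob_eq_1) auto
qed

text \<open>
  Memorylessness of the exponential law: given that it exceeds \<open>v\<close>, an exponential variable is \<open>v\<close> plus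
  a fresh exponential one, whose characteristic function is \<open>1 / (1 - \<i> t)\<close>. So replacing the maximum
  \<open>v\<close> by the overshooting value and multiplying by \<open>1 - \<i> t\<close> changes nothing on average.
\<close>
lemma integral_overshoot_exponential_eq_0:
  fixes t v :: real
  assumes "0 \<le> v"
  shows "(LINT u|density lborel (\<lambda>x. ennreal (exponential_density 1 x)).
           (if v < u then (1 - \<i> * t) * iexp (t * u) - iexp (t * v) else 0)) = 0"
proof -
  let ?D = "density lborel (\<lambda>x. ennreal (exponential_density 1 x))"
  let ?g = "\<lambda>u. (1 - \<i> * t) * iexp (t * u) - iexp (t * v)"
  let ?f = "\<lambda>u. exp (- u) *\<^sub>R ?g u"
  \<comment> \<open>an antiderivative of the integrand that vanishes both at \<open>v\<close> and at infinity\<close>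
  let ?F = "\<lambda>u. exp (- u) *\<^sub>R (iexp (t * v) - iexp (t * u))"
  interpret prob_space ?D by (rule prob_space_exponential_density) simp
  have "integrable ?D (\<lambda>u. if v < u then ?g u else 0)"
  proof (rule integrable_const_bound)
    show "AE u in ?D. norm (if v < u then ?g u else 0) \<le> cmod (1 - \<i> * t) + 1"
      by (intro AE_I2) (auto intro!: order_trans[OF norm_triangle_ineq4] simp: norm_mult)
  qed simp
  then have "integrable lborel (\<lambda>u. exponential_density 1 u *\<^sub>R (if v < u then ?g u else 0))"
    by (subst (asm) integrable_density) (auto simp: exponential_density_def)
  also have "(\<lambda>u. exponential_density 1 u *\<^sub>R (if v < u then ?g u else 0)) =
      (\<lambda>u. indicator {v<..} u *\<^sub>R ?f u)"
    using assms by (auto simp: fun_eq_iff exponential_density_def)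
  finally have int: "set_integrable lborel {v<..} ?f" by (simp add: set_integrable_def)
  have "(LINT u|?D. (if v < u then ?g u else 0)) = (LINT u:{v<..}|lborel. ?f u)"
    unfolding set_lebesgue_integral_def using assms
    by (subst integral_density)
       (auto simp: exponential_density_def intro!: Bochner_Integration.integral_cong AE_I2)
  also have "\<dots> = (LBINT u=ereal v..\<infinity>. ?f u)"
    by (simp add: interval_integral_to_infinity_eq)
  also have "\<dots> = 0 - ?F v"
  proof (rule interval_integral_FTC_integrable)
    show "(?F has_vector_derivative ?f u) (at u)" for u
      by (auto intro!: derivative_eq_intros has_vector_derivative_real_field simp: scaleR_conv_of_real algebra_simps)
    show "isCont ?f u" for u by (intro continuous_intros)
    show "set_integrable lborel (einterval (ereal v) \<infinity>) ?f" using int by simp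
    have "(?F \<longlongrightarrow> ?F v) (at_right v)" 
      by (rule tendsto_within_subset[of _ _ _ UNIV]) (auto intro!: tendsto_eq_intros)
    then show "((?F \<circ> real_of_ereal) \<longlongrightarrow> ?F v) (at_right (ereal v))"
      by (simp add: ereal_tendsto_simps)
    have "(?F \<longlongrightarrow> 0) at_top"
    proof (rule Lim_null_comparison)
      show "\<forall>\<^sub>F u in at_top. norm (?F u) \<le> 2 * exp (- u)"
      proof (intro always_eventually allI)
        fix u
        have "cmod (iexp (t * v) - iexp (t * u)) \<le> 2"
          by (intro order_trans[OF norm_triangle_ineq4]) simp
        then show "norm (?F u) \<le> 2 * exp (- u)" by simp
      qed
      show "((\<lambda>u::real. 2 * exp (- u)) \<longlongrightarrow> 0) at_top" by real_asymp
    qed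
    then show "((?F \<circ> real_of_ereal) \<longlongrightarrow> 0) (at_left \<infinity>)"
      by (simp add: ereal_tendsto_simps)
  qed simp
  finally show ?thesis by simp
qed

text \<open>
  Functions of independent variables are independent, as a statement about joint laws. Here the two
  functions may take values in different types, as needed for a scan state and a single observation.
\<close>
lemma (in prob_space) indep_var_joint_law_compose:
  assumes ind: "indep_var N1 U N2 W" and f: "f \<in> measurable N1 S" and g: "g \<in> measurable N2 T"
  shows "distr M S (\<lambda>\<omega>. f (U \<omega>)) \<Otimes>\<^sub>M distr M T (\<lambda>\<omega>. g (W \<omega>)) =
           distr M (S \<Otimes>\<^sub>M T) (\<lambda>\<omega>. (f (U \<omega>), g (W \<omega>)))"
proof -
  note [measurable] = f g indep_var_rv1[OF ind] indep_var_rv2[OF ind]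
  interpret W: prob_space "distr (distr M N2 W) T g"
    by (intro prob_space.prob_space_distr prob_space_distr) auto
  have "distr M S (\<lambda>\<omega>. f (U \<omega>)) \<Otimes>\<^sub>M distr M T (\<lambda>\<omega>. g (W \<omega>)) =
      distr (distr M N1 U) S f \<Otimes>\<^sub>M distr (distr M N2 W) T g"
    by (simp add: distr_distr comp_def)
  also have "\<dots> = distr (distr M N1 U \<Otimes>\<^sub>M distr M N2 W) (S \<Otimes>\<^sub>M T) (\<lambda>(x, y). (f x, g y))"
    by (rule pair_measure_distr) (auto intro: W.sigma_finite_measure_axioms)
  also have "distr M N1 U \<Otimes>\<^sub>M distr M N2 W = distr M (N1 \<Otimes>\<^sub>M N2) (\<lambda>\<omega>. (U \<omega>, W \<omega>))"
    using ind by (simp add: indep_var_distribution_eq)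
  also have "distr \<dots> (S \<Otimes>\<^sub>M T) (\<lambda>(x, y). (f x, g y)) =
      distr M (S \<Otimes>\<^sub>M T) (\<lambda>\<omega>. (f (U \<omega>), g (W \<omega>)))"
    by (subst distr_distr) (auto simp: comp_def)
  finally show ?thesis .
qed

text \<open>
  The process \<open>(1 - \<i> t) ^ N * exp (\<i> t V)\<close>, where \<open>N\<close> is the (frozen) number of records and \<open>V\<close> the
  running maximum, is a martingale. A step changes it only when the new observation exceeds \<open>V\<close>; that
  observation is independent of the current state, so by Fubini the mean change is an average of
  the overshoot integrals, all of which vanish.
\<close>
lemma (in prob_space) expectation_record_scan:
  fixes t :: real
  assumes indep: "indep_vars (\<lambda>_. borel) Y {1..}"
    and exp: "\<And>i::nat. 1 \<le> i \<Longrightarrow> distributed M lborel (Y i) (exponential_density 1)"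
  defines "Z \<equiv> \<lambda>(k, v). (1 - \<i> * t) ^ k * iexp (t * v)"
  shows "expectation (\<lambda>\<omega>. Z (record_scan n (\<lambda>i. Y i \<omega>) m)) = 1"
proof (induction m)
  case 0 show ?case by (simp add: Z_def prob_space)
next
  case (Suc m)
  let ?S = "count_space (UNIV :: nat set) \<Otimes>\<^sub>M (borel :: real measure)"
  let ?D = "density lborel (\<lambda>x. ennreal (exponential_density 1 x))"
  define s where "s = (\<lambda>\<omega>. record_scan n (\<lambda>i. Y i \<omega>) m)"
  define G where "G = (\<lambda>q. if fst (fst q) < n \<and> snd (fst q) < snd q
                       then Z (Suc (fst (fst q)), snd q) - Z (fst q) else 0)"
  define c where "c = 1 - \<i> * complex_of_real t"
  have c1: "1 \<le> cmod c" by (simp add: c_def cmod_def)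
  have Z_norm: "cmod (Z (k, v)) = cmod c ^ k" for k v
    by (simp add: Z_def c_def norm_mult norm_power)
  have Z_le: "cmod (Z p) \<le> cmod c ^ n" if "fst p \<le> n" for p
    using that c1 by (cases p) (auto simp: Z_norm intro: power_increasing)
  have Z_meas [measurable]: "Z \<in> borel_measurable ?S"
    unfolding Z_def by measurable
  have G_meas [measurable]: "G \<in> borel_measurable (?S \<Otimes>\<^sub>M borel)"
    unfolding G_def by measurable
  have meas: "Y i \<in> borel_measurable M" if "1 \<le> i" for i
    using distributed_measurable[OF exp[OF that]] by simp
  have s_meas [measurable]: "s \<in> measurable M ?S"
    unfolding s_def by (rule measurable_record_scan) (use meas in auto)
  have fst_s_le: "fst (s \<omega>) \<le> n" for \<omega>
    unfolding s_def by (rule fst_record_scan_le)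
  have Y_meas [measurable]: "Y (Suc m) \<in> borel_measurable M" using meas by simp
  have indep_m: "indep_var (Pi\<^sub>M {1..m} (\<lambda>_. borel)) (\<lambda>\<omega>. \<lambda>i\<in>{1..m}. Y i \<omega>)
      (Pi\<^sub>M {Suc m} (\<lambda>_. borel)) (\<lambda>\<omega>. \<lambda>i\<in>{Suc m}. Y i \<omega>)"
    by (intro indep_var_restrict[OF indep]) auto
  have joint: "distr M ?S s \<Otimes>\<^sub>M distr M borel (Y (Suc m)) =
      distr M (?S \<Otimes>\<^sub>M borel) (\<lambda>\<omega>. (s \<omega>, Y (Suc m) \<omega>))"
  proof -
    have "record_scan n (\<lambda>i\<in>{1..m}. Y i \<omega>) m = s \<omega>" for \<omega>
      unfolding s_def by (rule record_scan_cong) simp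
    moreover have "(\<lambda>y. record_scan n y m) \<in> measurable (Pi\<^sub>M {1..m} (\<lambda>_. borel)) ?S"
      by (rule measurable_record_scan) auto
    ultimately show ?thesis
      using indep_var_joint_law_compose[OF indep_m, of "\<lambda>y. record_scan n y m" ?S "\<lambda>y. y (Suc m)" borel]
      by simp
  qed
  have Y_distr: "distr M borel (Y (Suc m)) = ?D"
    using distributed_distr_eq_density[OF exp[of "Suc m"]]
    by (simp cong: distr_cong)
  \<comment> \<open>integrability with respect to \<open>M\<close>, as opposed to the product measure considered next\<close>
  note bounded_integrable = integrable_const_bound
  interpret S: prob_space "distr M ?S s" by (rule prob_space_distr) simp
  interpret D: prob_space ?D by (rule prob_space_exponential_density) simp
  interpret pair_prob_space "distr M ?S s" ?D ..
  have G_le: "cmod (G q) \<le> cmod c ^ n + cmod c ^ n" for q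
  proof -
    obtain k v u where q: "q = ((k, v), u)" by (metis prod.exhaust)
    have "cmod (Z (Suc k, u) - Z (k, v)) \<le> cmod c ^ n + cmod c ^ n" if "k < n"
      using that Z_le[of "(Suc k, u)"] Z_le[of "(k, v)"]
      by (intro order_trans[OF norm_triangle_ineq4] add_mono) auto
    then show ?thesis using c1 by (auto simp: q G_def)
  qed
  have G_int: "integrable (distr M ?S s \<Otimes>\<^sub>M ?D) G"
    by (rule P.integrable_const_bound[of _ "cmod c ^ n + cmod c ^ n"]) (rule AE_I2, rule G_le, simp)
  have inner: "(\<integral>u. G (p, u) \<partial>?D) = 0" if "0 \<le> snd p" for p
  proof -
    obtain k v where p: "p = (k, v)" by (cases p)
    have "(\<integral>u. G (p, u) \<partial>?D) = (\<integral>u. (if k < n then c ^ k else 0) *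
        (if v < u then (1 - \<i> * t) * iexp (t * u) - iexp (t * v) else 0) \<partial>?D)"
      by (rule Bochner_Integration.integral_cong) (auto simp: G_def Z_def p c_def algebra_simps)
    also have "\<dots> = 0"
      using integral_overshoot_exponential_eq_0[of v t] that by (simp add: p)
    finally show ?thesis .
  qed
  have "integral\<^sup>L M (\<lambda>\<omega>. G (s \<omega>, Y (Suc m) \<omega>)) =
      (\<integral>p. G p \<partial>distr M (?S \<Otimes>\<^sub>M borel) (\<lambda>\<omega>. (s \<omega>, Y (Suc m) \<omega>)))"
    by (simp add: integral_distr)
  also have "\<dots> = (\<integral>p. G p \<partial>(distr M ?S s \<Otimes>\<^sub>M ?D))"
    by (simp add: joint[symmetric] Y_distr)
  also have "\<dots> = (\<integral>p. (\<integral>u. G (p, u) \<partial>?D) \<partial>distr M ?S s)"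
    using integral_fst'[OF G_int] by simp
  also have "\<dots> = integral\<^sup>L M (\<lambda>\<omega>. \<integral>u. G (s \<omega>, u) \<partial>?D)"
    by (subst integral_distr) auto
  also have "\<dots> = 0"
    by (simp add: inner s_def snd_record_scan_nonneg)
  finally have G0: "integral\<^sup>L M (\<lambda>\<omega>. G (s \<omega>, Y (Suc m) \<omega>)) = 0" .
  \<comment> \<open>\<open>G\<close> is the increment of the process in the step from \<open>m\<close> to \<open>Suc m\<close>.\<close>
  have "Z (record_scan n (\<lambda>i. Y i \<omega>) (Suc m)) = Z (s \<omega>) + G (s \<omega>, Y (Suc m) \<omega>)" for \<omega>
    by (auto simp: s_def G_def split: prod.splits)
  moreover have "integrable M (\<lambda>\<omega>. Z (s \<omega>))"
    by (rule bounded_integrable[of _ "cmod c ^ n"])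
       (rule AE_I2, rule Z_le, simp_all add: fst_s_le)
  moreover have "integrable M (\<lambda>\<omega>. G (s \<omega>, Y (Suc m) \<omega>))"
    by (rule bounded_integrable[of _ "cmod c ^ n + cmod c ^ n"]) (rule AE_I2, rule G_le, simp)
  ultimately show ?case using Suc.IH G0 by (simp add: s_def)
qed

text \<open>
  The martingale is bounded by \<open>cmod (1 - \<i> t) ^ n\<close> and is eventually frozen at
  \<open>(1 - \<i> t) ^ n * exp (\<i> t S)\<close>, with \<open>S\<close> the \<open>n\<close>-th record value, so dominated convergence carries its
  mean over to the limit. The right-hand side is the characteristic function of a sum of \<open>n\<close>
  independent standard exponential variables.
\<close>
lemma (in prob_space) char_record_value_exponential:
  fixes t :: real
  assumes indep: "indep_vars (\<lambda>_. borel) Y {1..}"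
    and exp: "\<And>i::nat. 1 \<le> i \<Longrightarrow> distributed M lborel (Y i) (exponential_density 1)"
    and "1 \<le> n"
  shows "expectation (\<lambda>\<omega>. iexp (t * record_value (\<lambda>i. Y i \<omega>) n)) = 1 / (1 - \<i> * t) ^ n"
proof -
  define c where "c = 1 - \<i> * complex_of_real t"
  have c1: "1 \<le> cmod c" by (simp add: c_def cmod_def)
  then have "c \<noteq> 0" by auto
  have meas: "Y i \<in> borel_measurable M" if "1 \<le> i" for i
    using distributed_measurable[OF exp[OF that]] by simp
  note [measurable] = measurable_record_value[of Y M n, OF meas \<open>1 \<le> n\<close>]
  let ?f = "\<lambda>m \<omega>. case record_scan n (\<lambda>i. Y i \<omega>) m of (k, v) \<Rightarrow> c ^ k * iexp (t * v)"
  have "(\<lambda>m. expectation (?f m)) \<longlonglongrightarrow>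
      expectation (\<lambda>\<omega>. c ^ n * iexp (t * record_value (\<lambda>i. Y i \<omega>) n))"
  proof (rule integral_dominated_convergence[where w = "\<lambda>_. cmod c ^ n"])
    show "?f m \<in> borel_measurable M" for m
    proof -
      note [measurable] = measurable_record_scan[of m Y M n, OF meas]
      show ?thesis by measurable
    qed
    have "AE \<omega> in M. \<forall>c m. \<exists>j>m. c < Y j \<omega>"
      by (rule AE_unbounded_if_exponential) (use assms in auto)
    moreover have "AE \<omega> in M. 0 < Y 1 \<omega>"
      by (rule AE_pos_if_exponential) (use exp in simp)
    ultimately show "AE \<omega> in M. (\<lambda>m. ?f m \<omega>) \<longlonglongrightarrow> c ^ n * iexp (t * record_value (\<lambda>i. Y i \<omega>) n)"
    proof eventually_elim
      case (elim \<omega>)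
      have "\<forall>\<^sub>F m in sequentially.
          record_scan n (\<lambda>i. Y i \<omega>) m = (n, record_value (\<lambda>i. Y i \<omega>) n)"
        by (rule eventually_record_scan_eq) (use elim \<open>1 \<le> n\<close> in auto)
      then have "\<forall>\<^sub>F m in sequentially. ?f m \<omega> = c ^ n * iexp (t * record_value (\<lambda>i. Y i \<omega>) n)"
        by eventually_elim simp
      then show ?case by (rule tendsto_eventually)
    qed
    show "AE \<omega> in M. cmod (?f m \<omega>) \<le> cmod c ^ n" for m
    proof (intro AE_I2)
      fix \<omega>
      show "cmod (?f m \<omega>) \<le> cmod c ^ n"
        using fst_record_scan_le[of n "\<lambda>i. Y i \<omega>" m] c1
        by (auto simp: norm_mult norm_power split: prod.splits intro!: power_increasing)
    qed
  qed auto
  moreover have "expectation (?f m) = 1" for m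
    using expectation_record_scan[OF indep exp, of t n m] unfolding c_def by simp
  ultimately have "expectation (\<lambda>\<omega>. c ^ n * iexp (t * record_value (\<lambda>i. Y i \<omega>) n)) = 1"
    by (simp add: LIMSEQ_const_iff)
  then show ?thesis using \<open>c \<noteq> 0\<close> unfolding c_def[symmetric]
    by (simp add: field_simps)
qed

section \<open>Asymptotic normality of exponential records\<close>

text \<open>
  The left-hand side is the characteristic function of \<open>(S - n) / sqrt n\<close> for a variable \<open>S\<close> with the
  Erlang law of shape \<open>n\<close>. Writing \<open>1 - \<i> w\<close> in polar form separates the limit into two real ones:
  with \<open>w = t / sqrt n\<close>, the modulus \<open>(1 + w\<^sup>2) powr (- n / 2)\<close> produces the Gaussian, and the argument
  \<open>n (arctan w - w)\<close> is of order \<open>1 / sqrt n\<close>.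
\<close>
lemma char_standardised_erlang_tendsto:
  fixes t :: real
  shows "(\<lambda>n. iexp (- t * sqrt (real n)) / (1 - \<i> * (t / sqrt (real n))) ^ n) \<longlonglongrightarrow>
          complex_of_real (exp (- (t\<^sup>2) / 2))"
proof -
  have polar: "1 - \<i> * complex_of_real w = of_real (sqrt (1 + w\<^sup>2)) * cis (- arctan w)" for w
    using sum_power2_gt_zero_iff[of 1 w] by (auto simp: complex_eq_iff cos_arctan sin_arctan)
  have cis_iexp: "iexp x = cis x" for x by (simp add: cis_conv_exp)
  have eq: "iexp (- t * sqrt (real n)) / (1 - \<i> * (t / sqrt (real n))) ^ n =
      of_real (1 / sqrt (1 + (t / sqrt (real n))\<^sup>2) ^ n) *
      cis (real n * arctan (t / sqrt (real n)) - t * sqrt (real n))" for n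
    unfolding polar power_mult_distrib Complex.DeMoivre cis_iexp
    using cis_divide[of "- (t * sqrt (real n))" "- (real n * arctan (t / sqrt (real n)))"]
    by (simp add: power_divide field_simps)
  have "(\<lambda>n. 1 / sqrt (1 + (t / sqrt (real n))\<^sup>2) ^ n) \<longlonglongrightarrow> exp (- (t\<^sup>2) / 2)"
  proof -
    have "1 / sqrt (1 + (t / sqrt (real n))\<^sup>2) ^ n = exp (- (real n * ln (1 + t\<^sup>2 / real n) / 2))" for n
    proof -
      have "0 < 1 + t\<^sup>2 / real n" by (simp add: add_pos_nonneg)
      then have "sqrt (1 + t\<^sup>2 / real n) = exp (ln (1 + t\<^sup>2 / real n) / 2)"
        using exp_ln[of "sqrt (1 + t\<^sup>2 / real n)"] by (simp add: ln_sqrt)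
      then show ?thesis
        by (simp add: power_divide exp_minus inverse_eq_divide flip: exp_of_nat_mult)
    qed
    moreover have "(\<lambda>n. exp (- (real n * ln (1 + a / real n) / 2))) \<longlonglongrightarrow> exp (- a / 2)" if "0 < a" for a :: real
      using that by real_asymp
    ultimately show ?thesis by (cases "t = 0") auto
  qed
  moreover have "(\<lambda>n. real n * arctan (t / sqrt (real n)) - t * sqrt (real n)) \<longlonglongrightarrow> 0"
  proof (cases t "0 :: real" rule: linorder_cases)
    \<comment> \<open>the expansion of \<open>arctan\<close> at 0 is taken from the side given by the sign of \<open>t\<close>\<close>
    case less
    then show ?thesis by real_asymp
  next
    case greater
    then show ?thesis by real_asymp
  qed simp
  ultimately have "(\<lambda>n. of_real (1 / sqrt (1 + (t / sqrt (real n))\<^sup>2) ^ n) *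
      cis (real n * arctan (t / sqrt (real n)) - t * sqrt (real n))) \<longlonglongrightarrow>
      complex_of_real (exp (- (t\<^sup>2) / 2)) * cis 0"
    unfolding cis_conv_exp by (intro tendsto_intros)
  then show ?thesis unfolding eq by simp
qed

lemma (in prob_space) exponential_record_central_limit:
  assumes indep: "indep_vars (\<lambda>_. borel) Y {1..}"
    and exp: "\<And>i::nat. 1 \<le> i \<Longrightarrow> distributed M lborel (Y i) (exponential_density 1)"
  shows "weak_conv_m
           (\<lambda>n. distr M borel (\<lambda>\<omega>. (record_value (\<lambda>i. Y i \<omega>) n - real n) / sqrt (real n)))
           std_normal_distribution"
proof (rule levy_continuity)
  have meas: "Y i \<in> borel_measurable M" if "1 \<le> i" for i
    using distributed_measurable[OF exp[OF that]] by simp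
  have std_meas [measurable]:
    "(\<lambda>\<omega>. (record_value (\<lambda>i. Y i \<omega>) n - real n) / sqrt (real n)) \<in> borel_measurable M" for n
  \<comment> \<open>For \<open>n = 0\<close> the quotient is 0, as its denominator is.\<close>
  proof (cases "n = 0")
    case False
    then have [measurable]: "(\<lambda>\<omega>. record_value (\<lambda>i. Y i \<omega>) n) \<in> borel_measurable M"
      using measurable_record_value[of Y M n] meas by simp
    show ?thesis by measurable
  qed simp
  show "real_distribution
      (distr M borel (\<lambda>\<omega>. (record_value (\<lambda>i. Y i \<omega>) n - real n) / sqrt (real n)))" for n
    by (rule real_distribution_distr) (rule std_meas)
  show "real_distribution std_normal_distribution" by (rule real_dist_normal_dist)
  fix t :: real
  let ?S = "\<lambda>n \<omega>. record_value (\<lambda>i. Y i \<omega>) n"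
  have "char (distr M borel (\<lambda>\<omega>. (?S n \<omega> - real n) / sqrt (real n))) t =
      iexp (- t * sqrt (real n)) / (1 - \<i> * (t / sqrt (real n))) ^ n" if n: "1 \<le> n" for n
  proof -
    have *: "iexp (t * ((?S n \<omega> - real n) / sqrt (real n))) =
        iexp (- t * sqrt (real n)) * iexp ((t / sqrt (real n)) * ?S n \<omega>)" for \<omega>
    proof -
      have "t * ((?S n \<omega> - real n) / sqrt (real n)) =
          - t * sqrt (real n) + (t / sqrt (real n)) * ?S n \<omega>"
        using n real_sqrt_mult_self[of "real n"] by (simp add: field_simps)
      then show ?thesis by (simp only: of_real_add distrib_left exp_add)
    qed
    have "char (distr M borel (\<lambda>\<omega>. (?S n \<omega> - real n) / sqrt (real n))) t =
        expectation (\<lambda>\<omega>. iexp (t * ((?S n \<omega> - real n) / sqrt (real n))))"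
      unfolding char_def by (subst integral_distr) auto
    also have "\<dots> = iexp (- t * sqrt (real n)) * expectation (\<lambda>\<omega>. iexp ((t / sqrt (real n)) * ?S n \<omega>))"
      unfolding * by simp
    also have "\<dots> = iexp (- t * sqrt (real n)) / (1 - \<i> * (t / sqrt (real n))) ^ n"
      using char_record_value_exponential[OF indep exp n, of "t / sqrt (real n)"] by simp
    finally show ?thesis .
  qed
  then have "\<forall>\<^sub>F n in sequentially.
      iexp (- t * sqrt (real n)) / (1 - \<i> * (t / sqrt (real n))) ^ n =
      char (distr M borel (\<lambda>\<omega>. (?S n \<omega> - real n) / sqrt (real n))) t"
    unfolding eventually_sequentially by metis
  from Lim_transform_eventually[OF char_standardised_erlang_tendsto this]
  show "(\<lambda>n. char (distr M borel (\<lambda>\<omega>. (?S n \<omega> - real n) / sqrt (real n))) t) \<longlonglongrightarrow>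
      char std_normal_distribution t"
    by (simp add: char_std_normal_distribution)
qed

section \<open>Convergence of distribution functions at moving points\<close>

text \<open>
  Monotonicity squeezes \<open>Fs n (s n)\<close> between the values of \<open>Fs n\<close> at fixed points on either side of
  the limit point, and continuity lets these points close in.
\<close>
lemma weak_conv_at_moving_point:
  fixes F :: "real \<Rightarrow> real"
  assumes conv: "weak_conv Fs F" and mono: "\<And>n. mono (Fs n)"
    and cont: "\<And>x. isCont F x" and s: "s \<longlonglongrightarrow> x"
  shows "(\<lambda>n. Fs n (s n)) \<longlonglongrightarrow> F x"
proof (rule order_tendstoI)
  have lim: "(\<lambda>n. Fs n z) \<longlonglongrightarrow> F z" for z
    using conv cont by (simp add: weak_conv_def)
  {
    fix a assume "a < F x"
    then have "\<forall>\<^sub>F z in at_left x. a < F z"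
      using cont[of x] by (intro order_tendstoD(1)[of F "F x"])
        (auto simp: isCont_def filterlim_at_split)
    then obtain z where z: "z < x" "a < F z"
      by (metis eventually_at_left_field dense order_less_irrefl)
    show "\<forall>\<^sub>F n in sequentially. a < Fs n (s n)"
      using order_tendstoD(1)[OF lim z(2)] order_tendstoD(1)[OF s z(1)]
    proof eventually_elim
      case (elim n)
      have "Fs n z \<le> Fs n (s n)" using mono elim(2) by (intro monoD[of "Fs n"]) auto
      then show ?case using elim(1) by simp
    qed
  }
  {
    fix a assume "F x < a"
    then have "\<forall>\<^sub>F z in at_right x. F z < a"
      using cont[of x] by (intro order_tendstoD(2)[of F "F x"])
        (auto simp: isCont_def filterlim_at_split)
    then obtain z where z: "x < z" "F z < a"
      by (metis eventually_at_right_field dense order_less_irrefl)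
    show "\<forall>\<^sub>F n in sequentially. Fs n (s n) < a"
      using order_tendstoD(2)[OF lim z(2)] order_tendstoD(2)[OF s z(1)]
    proof eventually_elim
      case (elim n)
      have "Fs n (s n) \<le> Fs n z" using mono elim(2) by (intro monoD[of "Fs n"]) auto
      then show ?case using elim(1) by simp
    qed
  }
qed

lemma isCont_cdf_std_normal: "isCont (cdf std_normal_distribution) x"
proof -
  interpret real_distribution std_normal_distribution by (rule real_dist_normal_dist)
  have "emeasure std_normal_distribution {x} = 0"
    by (subst emeasure_density) (auto simp: nn_integral_indicator_singleton)
  then show ?thesis by (simp add: isCont_cdf measure_def)
qed

section \<open>The cumulative hazard of the Pseudo-Lindley law\<close>

text \<open>
  This is \<open>- ln (1 - F x)\<close> for the Pseudo-Lindley distribution function \<open>F\<close> at \<open>x \<ge> 0\<close>. The equality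
  does not extend to all \<open>x < 0\<close>, where \<open>F\<close> is 0.
\<close>

definition pseudo_lindley_cum_hazard :: "real \<Rightarrow> real \<Rightarrow> real \<Rightarrow> real" where
  "pseudo_lindley_cum_hazard \<theta> \<beta> x = \<theta> * x - ln ((\<beta> + \<theta> * x) / \<beta>)"

lemma cdf_pseudo_lindley_eq_cum_hazard:
  assumes "\<theta> > 0" "\<beta> > 1" "x \<ge> 0"
  shows "cdf (pseudo_lindley \<theta> \<beta>) x = 1 - exp (- pseudo_lindley_cum_hazard \<theta> \<beta> x)"
proof -
  have "\<beta> + \<theta> * x > 0" using assms by (intro add_pos_nonneg) auto
  then show ?thesis
    using assms by (simp add: cdf_pseudo_lindley pseudo_lindley_cum_hazard_def exp_diff exp_minus field_simps)
qed

text \<open>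
  On the nonnegative half-line the derivative \<open>\<theta> - \<theta> / (\<beta> + \<theta> x)\<close> is positive because \<open>\<beta> + \<theta> x > 1\<close>; the
  estimate \<open>ln u \<le> u - 1\<close> gives the same without differentiating.
\<close>
lemma pseudo_lindley_cum_hazard_strict_mono:
  assumes "\<theta> > 0" "\<beta> > 1" "0 \<le> x" "x < y"
  shows "pseudo_lindley_cum_hazard \<theta> \<beta> x < pseudo_lindley_cum_hazard \<theta> \<beta> y"
proof -
  have gt1: "\<beta> + \<theta> * x > 1" "\<beta> + \<theta> * y > 1"
    using assms mult_nonneg_nonneg[of \<theta> x] mult_nonneg_nonneg[of \<theta> y] by linarith+
  have "ln (\<beta> + \<theta> * y) - ln (\<beta> + \<theta> * x) = ln ((\<beta> + \<theta> * y) / (\<beta> + \<theta> * x))"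
    using gt1 by (simp add: ln_div)
  also have "\<dots> \<le> (\<beta> + \<theta> * y) / (\<beta> + \<theta> * x) - 1"
    using gt1 by (intro ln_le_minus_one) auto
  also have "\<dots> = \<theta> * (y - x) / (\<beta> + \<theta> * x)"
    using gt1 by (simp add: field_simps)
  also have "\<dots> < \<theta> * (y - x)"
    using gt1 assms by (simp add: divide_less_eq)
  finally show ?thesis
    using gt1 assms by (simp add: pseudo_lindley_cum_hazard_def ln_div algebra_simps)
qed

lemma pseudo_lindley_cum_hazard_surj:
  assumes "\<theta> > 0" "\<beta> > 1" "0 \<le> a"
  obtains x where "0 \<le> x" "pseudo_lindley_cum_hazard \<theta> \<beta> x = a"
proof -
  let ?R = "pseudo_lindley_cum_hazard \<theta> \<beta>"
  have "filterlim ?R at_top at_top"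
    unfolding pseudo_lindley_cum_hazard_def using assms by real_asymp
  then have "\<forall>\<^sub>F x in at_top. a \<le> ?R x \<and> 0 \<le> x"
    by (intro eventually_conj eventually_ge_at_top) (simp add: filterlim_at_top)
  then obtain b where b: "a \<le> ?R b" "0 \<le> b"
    by (auto simp: eventually_at_top_linorder)
  have "continuous_on {0..b} ?R"
  proof -
    have "\<beta> + \<theta> * x > 0" if "x \<in> {0..b}" for x
      using that assms by (intro add_pos_nonneg) auto
    then show ?thesis unfolding pseudo_lindley_cum_hazard_def
      using assms by (intro continuous_intros) (auto simp: less_imp_neq[symmetric])
  qed
  then have "\<exists>x\<ge>0. x \<le> b \<and> ?R x = a"
    using assms b by (intro IVT') (auto simp: pseudo_lindley_cum_hazard_def)
  then show thesis using that by auto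
qed

lemma (in prob_space) cdf_distr_eq_prob:
  assumes "Z \<in> borel_measurable M"
  shows "cdf (distr M borel Z) x = prob {\<omega> \<in> space M. Z \<omega> \<le> x}"
  using assms by (auto simp: cdf_def measure_distr intro!: arg_cong[where f = prob])

lemma (in prob_space) pseudo_lindley_AE_pos:
  assumes [measurable]: "Z \<in> borel_measurable M"
    and "\<theta> > 0" "\<beta> > 1" and cdf: "cdf (distr M borel Z) = cdf (pseudo_lindley \<theta> \<beta>)"
  shows "AE \<omega> in M. 0 < Z \<omega>"
proof -
  have "prob {\<omega> \<in> space M. Z \<omega> \<le> 0} = cdf (distr M borel Z) 0"
    by (simp add: cdf_distr_eq_prob)
  also have "\<dots> = 0" using assms by (simp add: cdf_pseudo_lindley)
  finally have "prob {\<omega> \<in> space M. Z \<omega> \<le> 0} = 0" .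
  then show ?thesis
    by (intro AE_I[of _ _ "{\<omega> \<in> space M. Z \<omega> \<le> 0}"]) (auto simp: emeasure_eq_measure)
qed

text \<open>
  The probability integral transform: below the quantile \<open>x\<close> with cumulative hazard \<open>a\<close> lies mass
  \<open>1 - exp (- a)\<close>.
\<close>
lemma (in prob_space) pseudo_lindley_cum_hazard_exponential:
  assumes Z [measurable]: "Z \<in> borel_measurable M"
    and "\<theta> > 0" "\<beta> > 1" and cdf: "cdf (distr M borel Z) = cdf (pseudo_lindley \<theta> \<beta>)"
  shows "distributed M lborel (\<lambda>\<omega>. pseudo_lindley_cum_hazard \<theta> \<beta> (Z \<omega>)) (exponential_density 1)"
proof (rule exponential_distributedI)
  let ?R = "pseudo_lindley_cum_hazard \<theta> \<beta>"
  show meas [measurable]: "(\<lambda>\<omega>. ?R (Z \<omega>)) \<in> borel_measurable M"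
    unfolding pseudo_lindley_cum_hazard_def by measurable
  fix a :: real assume "0 \<le> a"
  then obtain x where x: "0 \<le> x" "?R x = a"
    using pseudo_lindley_cum_hazard_surj assms by blast
  have "AE \<omega> in M. 0 < Z \<omega>" by (rule pseudo_lindley_AE_pos) fact+
  then have "prob {\<omega> \<in> space M. ?R (Z \<omega>) \<le> a} = prob {\<omega> \<in> space M. Z \<omega> \<le> x}"
  proof (intro finite_measure_eq_AE, eventually_elim)
    case (elim \<omega>)
    then show ?case
      using pseudo_lindley_cum_hazard_strict_mono[OF assms(2,3), of "Z \<omega>" x]
        pseudo_lindley_cum_hazard_strict_mono[OF assms(2,3), of x "Z \<omega>"] x
      by (cases "Z \<omega>" x rule: linorder_cases) auto
  qed auto
  also have "\<dots> = cdf (distr M borel Z) x"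
    by (simp add: cdf_distr_eq_prob)
  also have "\<dots> = 1 - exp (- a)"
    using cdf_pseudo_lindley_eq_cum_hazard[OF assms(2,3) x(1)] x cdf by simp
  finally show "emeasure M {\<omega> \<in> space M. ?R (Z \<omega>) \<le> a} = 1 - ennreal (exp (- a * 1))"
    by (simp add: emeasure_eq_measure ennreal_minus del: ennreal_1 flip: ennreal_1)
qed simp

section \<open>Asymptotic normality of Pseudo-Lindley records\<close>

text \<open>
  Record values commute with strictly increasing maps. Finiteness of the record time is essential, as
  the conventional value 0 of a missing record need not be mapped to 0.
\<close>
lemma record_value_strict_mono_image:
  assumes pos: "\<And>i. 1 \<le> i \<Longrightarrow> 0 \<le> x i"
    and mono: "\<And>a b. 0 \<le> a \<Longrightarrow> a < b \<Longrightarrow> g a < (g b :: real)"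
    and "1 \<le> n" and fin: "record_time (\<lambda>i. g (x i)) n \<noteq> \<infinity>"
  shows "record_value (\<lambda>i. g (x i)) n = g (record_value x n) \<and> 0 \<le> record_value x n"
proof -
  have "x i < x j \<longleftrightarrow> g (x i) < g (x j)" if "1 \<le> i" "1 \<le> j" for i j
    using mono[of "x i" "x j"] mono[of "x j" "x i"] pos[of i] pos[of j] that
    by (cases "x i" "x j" rule: linorder_cases) auto
  then have same: "record_time x n = record_time (\<lambda>i. g (x i)) n"
    by (rule record_time_eq_if_same_order)
  obtain k where k: "record_time x n = enat k" using fin same by auto
  moreover have "1 \<le> k" using k \<open>1 \<le> n\<close> record_time_pos by (cases n) auto
  ultimately show ?thesis using same pos by (simp add: record_value_def)
qed

theorem theorem3:
  fixes M :: "'a measure" and X :: "nat \<Rightarrow> 'a \<Rightarrow> real" and \<theta> \<beta> \<gamma> :: real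
  assumes "prob_space M"
    and "\<theta> > 0" and "\<beta> > 1" and "\<gamma> = 1 / \<theta>"
    and "prob_space.indep_vars M (\<lambda>_. borel) X {1..}"
    and "\<And>i. i \<ge> 1 \<Longrightarrow> cdf (distr M borel (X i)) = cdf (pseudo_lindley \<theta> \<beta>)"
  shows "weak_conv_m
           (\<lambda>n. distr M borel
             (\<lambda>\<omega>. (record_value (\<lambda>i. X i \<omega>) n - \<gamma> * real n) / (\<gamma> * sqrt (real n))))
           std_normal_distribution"
proof -
  interpret prob_space M by fact
  let ?R = "pseudo_lindley_cum_hazard \<theta> \<beta>"
  define Y where "Y = (\<lambda>i \<omega>. ?R (X i \<omega>))"
  let ?V = "\<lambda>n \<omega>. record_value (\<lambda>i. X i \<omega>) n"
  let ?S = "\<lambda>n \<omega>. record_value (\<lambda>i. Y i \<omega>) n"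
  have R_meas [measurable]: "?R \<in> borel_measurable borel"
    unfolding pseudo_lindley_cum_hazard_def by measurable
  have X_meas: "X i \<in> borel_measurable M" if "1 \<le> i" for i
    using assms(5) that unfolding indep_vars_def by auto
  have Y_indep: "indep_vars (\<lambda>_. borel) Y {1..}"
    unfolding Y_def by (rule indep_vars_compose2[OF assms(5)]) simp
  have Y_exp: "distributed M lborel (Y i) (exponential_density 1)" if "1 \<le> i" for i
    unfolding Y_def
    by (rule pseudo_lindley_cum_hazard_exponential) (use assms(2,3) assms(6)[OF that] X_meas[OF that] in auto)
  have Y_meas: "Y i \<in> borel_measurable M" if "1 \<le> i" for i
    using distributed_measurable[OF Y_exp[OF that]] by simp
  have V_meas: "?V n \<in> borel_measurable M" if "1 \<le> n" for n
    using that by (intro measurable_record_value X_meas)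
  have S_meas: "?S n \<in> borel_measurable M" if "1 \<le> n" for n
    using that by (intro measurable_record_value Y_meas)
  have X_pos: "AE \<omega> in M. \<forall>i. 1 \<le> i \<longrightarrow> 0 < X i \<omega>"
    unfolding AE_all_countable
  proof
    fix i
    show "AE \<omega> in M. 1 \<le> i \<longrightarrow> 0 < X i \<omega>"
    proof (cases "1 \<le> i")
      case True
      have "AE \<omega> in M. 0 < X i \<omega>"
        by (rule pseudo_lindley_AE_pos[OF X_meas[OF True] assms(2,3) assms(6)[OF True]])
      then show ?thesis by eventually_elim simp
    qed simp
  qed
  have Y_unbounded: "AE \<omega> in M. \<forall>c m. \<exists>j>m. c < Y j \<omega>"
    by (rule AE_unbounded_if_exponential[OF Y_indep Y_exp])
  have V_S: "AE \<omega> in M. ?S n \<omega> = ?R (?V n \<omega>) \<and> 0 \<le> ?V n \<omega>" if n: "1 \<le> n" for n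
    using X_pos Y_unbounded AE_pos_if_exponential[OF Y_exp[OF order_refl]]
  proof eventually_elim
    case (elim \<omega>)
    have "record_time (\<lambda>i. Y i \<omega>) n \<noteq> \<infinity>"
      by (rule eventually_record_scan_eq) (use elim n in auto)
    then have "record_time (\<lambda>i. ?R (X i \<omega>)) n \<noteq> \<infinity>"
      by (simp only: Y_def not_False_eq_True)
    then have "record_value (\<lambda>i. ?R (X i \<omega>)) n = ?R (?V n \<omega>) \<and> 0 \<le> ?V n \<omega>"
      by (intro record_value_strict_mono_image pseudo_lindley_cum_hazard_strict_mono assms n)
         (use elim in \<open>auto simp: less_imp_le\<close>)
    then show ?case by (simp only: Y_def)
  qed
  define Fs where "Fs = (\<lambda>n. cdf (distr M borel (\<lambda>\<omega>. (?S n \<omega> - real n) / sqrt (real n))))"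
  have Fs_conv: "weak_conv Fs (cdf std_normal_distribution)"
    using exponential_record_central_limit[OF Y_indep Y_exp] by (simp add: Fs_def weak_conv_m_def)
  have S_std_meas: "(\<lambda>\<omega>. (?S n \<omega> - real n) / sqrt (real n)) \<in> borel_measurable M" for n
    using S_meas[of n] by (cases "n = 0") auto
  have Fs_mono: "mono (Fs n)" for n
  proof -
    interpret D: real_distribution "distr M borel (\<lambda>\<omega>. (?S n \<omega> - real n) / sqrt (real n))"
      by (rule real_distribution_distr) (rule S_std_meas)
    show ?thesis unfolding Fs_def by (intro monoI D.cdf_nondecreasing)
  qed
  have "(\<lambda>n. cdf (distr M borel (\<lambda>\<omega>. (?V n \<omega> - \<gamma> * real n) / (\<gamma> * sqrt (real n)))) t) \<longlonglongrightarrow>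
      cdf std_normal_distribution t" for t
  proof -
    \<comment> \<open>\<open>x n\<close> is the threshold for the record value itself, and \<open>s n\<close> the corresponding threshold for
      the standardised exponential record.\<close>
    define x where "x = (\<lambda>n. \<gamma> * (real n + t * sqrt (real n)))"
    define s where "s = (\<lambda>n. (?R (x n) - real n) / sqrt (real n))"
    have "s \<longlonglongrightarrow> t"
    proof -
      have \<gamma>: "\<theta> * (\<gamma> * z) = z" for z using assms(2,4) by simp
      \<comment> \<open>The logarithm in the cumulative hazard is lost in the division by \<open>sqrt n\<close>.\<close>
      have "s = (\<lambda>n. (real n + t * sqrt (real n) -
          ln ((\<beta> + (real n + t * sqrt (real n))) / \<beta>) - real n) / sqrt (real n))"
        unfolding s_def x_def pseudo_lindley_cum_hazard_def \<gamma> ..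
      also have "\<dots> \<longlonglongrightarrow> t" using \<open>\<beta> > 1\<close> by real_asymp
      finally show ?thesis .
    qed
    then have "(\<lambda>n. Fs n (s n)) \<longlonglongrightarrow> cdf std_normal_distribution t"
      by (rule weak_conv_at_moving_point[OF Fs_conv Fs_mono isCont_cdf_std_normal])
    moreover have "\<forall>\<^sub>F n in sequentially. Fs n (s n) =
        cdf (distr M borel (\<lambda>\<omega>. (?V n \<omega> - \<gamma> * real n) / (\<gamma> * sqrt (real n)))) t"
    proof -
      have "\<forall>\<^sub>F n in sequentially. 0 \<le> real n + t * sqrt (real n)" by real_asymp
      then show ?thesis using eventually_ge_at_top[of 1]
      proof eventually_elim
        case (elim n)
        have \<gamma>: "0 < \<gamma>" using assms(2,4) by simp
        have sq: "0 < sqrt (real n)" using elim by simp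
        have x0: "0 \<le> x n" using elim \<gamma> by (simp add: x_def)
        note [measurable] = V_meas[OF elim(2)] S_meas[OF elim(2)]
        have "Fs n (s n) = prob {\<omega> \<in> space M. (?S n \<omega> - real n) / sqrt (real n) \<le> s n}"
          unfolding Fs_def by (rule cdf_distr_eq_prob[OF S_std_meas])
        also have "\<dots> = prob {\<omega> \<in> space M. (?V n \<omega> - \<gamma> * real n) / (\<gamma> * sqrt (real n)) \<le> t}"
        proof (rule finite_measure_eq_AE)
          from V_S[OF elim(2)]
          show "AE \<omega> in M. (\<omega> \<in> {\<omega> \<in> space M. (?S n \<omega> - real n) / sqrt (real n) \<le> s n}) =
              (\<omega> \<in> {\<omega> \<in> space M. (?V n \<omega> - \<gamma> * real n) / (\<gamma> * sqrt (real n)) \<le> t})"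
          proof eventually_elim
            fix \<omega> assume \<omega>: "?S n \<omega> = ?R (?V n \<omega>) \<and> 0 \<le> ?V n \<omega>"
            have "(?S n \<omega> - real n) / sqrt (real n) \<le> s n \<longleftrightarrow> ?R (?V n \<omega>) \<le> ?R (x n)"
              using \<omega> sq by (simp add: s_def divide_le_cancel)
            also have "\<dots> \<longleftrightarrow> ?V n \<omega> \<le> x n"
              using pseudo_lindley_cum_hazard_strict_mono[OF assms(2,3), of "?V n \<omega>" "x n"]
                pseudo_lindley_cum_hazard_strict_mono[OF assms(2,3), of "x n" "?V n \<omega>"] \<omega> x0
              by (cases "?V n \<omega>" "x n" rule: linorder_cases) auto
            also have "\<dots> \<longleftrightarrow> (?V n \<omega> - \<gamma> * real n) / (\<gamma> * sqrt (real n)) \<le> t"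
              using \<gamma> sq by (simp add: x_def pos_divide_le_eq algebra_simps)
            finally show "(\<omega> \<in> {\<omega> \<in> space M. (?S n \<omega> - real n) / sqrt (real n) \<le> s n}) =
              (\<omega> \<in> {\<omega> \<in> space M. (?V n \<omega> - \<gamma> * real n) / (\<gamma> * sqrt (real n)) \<le> t})"
              by simp
          qed
        next
          show "{\<omega> \<in> space M. (?S n \<omega> - real n) / sqrt (real n) \<le> s n} \<in> events" by measurable
          show "{\<omega> \<in> space M. (?V n \<omega> - \<gamma> * real n) / (\<gamma> * sqrt (real n)) \<le> t} \<in> events"
            by measurable
        qed
        also have "\<dots> = cdf (distr M borel (\<lambda>\<omega>. (?V n \<omega> - \<gamma> * real n) / (\<gamma> * sqrt (real n)))) t"
          by (rule cdf_distr_eq_prob[symmetric]) measurable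
        finally show ?case .
      qed
    qed
    ultimately show ?thesis by (rule Lim_transform_eventually)
  qed
  then show ?thesis by (simp add: weak_conv_m_def weak_conv_def)
qed

end
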